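(* Let $N\ge 0$ be an integer. Consider the source-free infinite radiation moment system $\partial_t\mathbf{u}=R\mathbf{u}$ with $R=-\mathbf{B}\partial_x-\mathbf{C}$, the splitting of $\mathbf{u}=(u_0,u_1,\dots)^T$ into $\mathbf{u}_C=(u_0,\dots,u_N)^T$ and $\mathbf{u}_F=(u_{N+1},u_{N+2},\dots)^T$, and an infinite symmetric positive definite matrix $\mathbf{A}$, as in the context. Then the operator $\mathcal{R}_{CC}=(R\mathbf{E})_{CC}$ of the first order optimal prediction system $\partial_t\mathbf{u}_C=\mathcal{R}_{CC}\mathbf{u}_C$ is $$\mathcal{R}_{CC}=-\left(\mathbf{B}_{CC}+\mathbf{B}_{CF}\mathbf{A}_{FC}\mathbf{A}_{CC}^{-1}\right)\partial_x-\mathbf{C}_{CC}.$$ The matrix $\mathbf{B}_{CF}\mathbf{A}_{FC}\mathbf{A}_{CC}^{-1}$ has nonzero entries only in its last row, and this last row equals $\frac{N+1}{2N+1}$ times the first row of $\mathbf{A}_{FC}\mathbf{A}_{CC}^{-1}$. In particular, if $\mathbf{A}_{FC}=\mathbf{0}$, then the first order optimal prediction system is exactly the (source-free) $P_N$ closure.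
   Context: Let $\sigma_{a0},\sigma_{a1},\dots$ be real constants. The infinite moment system for $u_k=u_k(x,t)$, $x\in\mathbb{R}$, $t>0$, $k=0,1,2,\dots$, is $$\partial_tu_k+b_{k,k-1}\partial_xu_{k-1}+b_{k,k+1}\partial_xu_{k+1}=-\sigma_{ak}u_k,\qquad b_{kl}=\tfrac{k+1}{2k+1}\delta_{k+1,l}+\tfrac{k}{2k+1}\delta_{k-1,l},$$ i.e. $\partial_t\mathbf{u}=R\mathbf{u}$ with $R=-\mathbf{B}\partial_x-\mathbf{C}$, where $\mathbf{B}=(b_{kl})_{k,l\ge0}$ is tridiagonal and $\mathbf{C}=\mathrm{diag}(\sigma_{a0},\sigma_{a1},\dots)$. For $k=0$ the term with $u_{-1}$ is absent. All matrices and operators are split into blocks $CC$, $CF$, $FC$, $FF$ according to the index sets $\{0,\dots,N\}$ (for $C$) and $\{N+1,N+2,\dots\}$ (for $F$). $\mathbf{A}$ is a real symmetric infinite matrix indexed by $\{0,1,2,\dots\}$ all of whose finite principal submatrices are positive definite. The projection matrix is $$\mathbf{E}=\begin{bmatrix}\mathbf{I}&\mathbf{0}\\ \mathbf{A}_{FC}\mathbf{A}_{CC}^{-1}&\mathbf{0}\end{bmatrix}.$$ First order optimal prediction is the system $\partial_t\mathbf{u}_C=(R\mathbf{E})_{CC}\mathbf{u}_C$. The source-free $P_N$ closure is the system for $u_0,\dots,u_N$ obtained from the equations $k=0,\dots,N$ of the moment system by setting $u_l=0$ for all $l>N$. *)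

theory Defs
  imports "HOL-Analysis.Derivative" "Jordan_Normal_Form.Gauss_Jordan_Elimination"
    "Jordan_Normal_Form.Determinant"
begin

section \<open>Infinite matrices and their blocks\<close>

text \<open>
  Infinite matrices are functions \<open>nat \<Rightarrow> nat \<Rightarrow> real\<close>. A block keeps the original row and column
  indices and is zero outside its index sets, so the products of blocks are products of infinite
  matrices. In particular the first row of an \<open>FC\<close> block is the row with index \<open>N + 1\<close>, and the
  last row of a \<open>CF\<close> or \<open>CC\<close> block is the row with index \<open>N\<close>.
\<close>

type_synonym imat = "nat \<Rightarrow> nat \<Rightarrow> real"

definition idxC :: "nat \<Rightarrow> nat set" where
  "idxC N = {0..N}"

definition idxF :: "nat \<Rightarrow> nat set" where
  "idxF N = {N + 1..}"

definition mblock :: "nat set \<Rightarrow> nat set \<Rightarrow> imat \<Rightarrow> imat" where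
  "mblock I J M i j = (if i \<in> I \<and> j \<in> J then M i j else 0)"

abbreviation blkCC :: "nat \<Rightarrow> imat \<Rightarrow> imat" where
  "blkCC N \<equiv> mblock (idxC N) (idxC N)"

abbreviation blkCF :: "nat \<Rightarrow> imat \<Rightarrow> imat" where
  "blkCF N \<equiv> mblock (idxC N) (idxF N)"

abbreviation blkFC :: "nat \<Rightarrow> imat \<Rightarrow> imat" where
  "blkFC N \<equiv> mblock (idxF N) (idxC N)"

text \<open>The series below are only used where all but finitely many terms vanish.\<close>

definition mmul :: "imat \<Rightarrow> imat \<Rightarrow> imat" where
  "mmul M P i j = (\<Sum>l. M i l * P l j)"

definition symmetric_imat :: "imat \<Rightarrow> bool" where
  "symmetric_imat A \<longleftrightarrow> (\<forall>i j. A i j = A j i)"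

definition pos_def_imat :: "imat \<Rightarrow> bool" where
  "pos_def_imat A \<longleftrightarrow>
     (\<forall>S. finite S \<longrightarrow>
        (\<forall>v. (\<exists>i\<in>S. v i \<noteq> 0) \<longrightarrow> (\<Sum>i\<in>S. \<Sum>j\<in>S. v i * A i j * v j) > 0))"

definition fin_CC :: "nat \<Rightarrow> imat \<Rightarrow> real mat" where
  "fin_CC N A = mat (N + 1) (N + 1) (\<lambda>(i, j). A i j)"

definition inv_CC :: "nat \<Rightarrow> imat \<Rightarrow> imat" where
  "inv_CC N A i j =
     (if i \<in> idxC N \<and> j \<in> idxC N then the (mat_inverse (fin_CC N A)) $$ (i, j) else 0)"

text \<open>The matrix inverse used in \<open>inv_CC\<close> exists for every matrix \<open>A\<close> under consideration.\<close>

lemma inverse_fin_CC: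
  assumes "pos_def_imat A"
  obtains X where "mat_inverse (fin_CC N A) = Some X"
    and "X \<in> carrier_mat (N + 1) (N + 1)"
    and "fin_CC N A * X = 1\<^sub>m (N + 1)" and "X * fin_CC N A = 1\<^sub>m (N + 1)"
proof -
  let ?M = "fin_CC N A"
  have M: "?M \<in> carrier_mat (N + 1) (N + 1)" by (simp add: fin_CC_def)
  have "det ?M \<noteq> 0"
  proof
    assume "det ?M = 0"
    then obtain v where v: "v \<in> carrier_vec (N + 1)" "v \<noteq> 0\<^sub>v (N + 1)"
      and z: "?M *\<^sub>v v = 0\<^sub>v (N + 1)"
      using det_0_iff_vec_prod_zero[OF M] by blast
    have "\<exists>i\<in>{0..<N + 1}. v $ i \<noteq> 0"
    proof (rule ccontr)
      assume "\<not> ?thesis"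
      then have "v = 0\<^sub>v (N + 1)" using v(1) by (intro eq_vecI) auto
      with v(2) show False by simp
    qed
    then have pos: "(\<Sum>i\<in>{0..<N + 1}. \<Sum>j\<in>{0..<N + 1}. v $ i * A i j * v $ j) > 0"
      using assms[unfolded pos_def_imat_def, rule_format, of "{0..<N + 1}" "\<lambda>i. v $ i"]
      by blast
    have row: "(\<Sum>j\<in>{0..<N + 1}. A i j * v $ j) = 0" if "i < N + 1" for i
    proof -
      have "(?M *\<^sub>v v) $ i = (\<Sum>j\<in>{0..<N + 1}. A i j * v $ j)"
        using that v(1) by (simp add: fin_CC_def scalar_prod_def)
      with z that show ?thesis by simp
    qed
    have "(\<Sum>i\<in>{0..<N + 1}. \<Sum>j\<in>{0..<N + 1}. v $ i * A i j * v $ j)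
      = (\<Sum>i\<in>{0..<N + 1}. v $ i * (\<Sum>j\<in>{0..<N + 1}. A i j * v $ j))"
      by (simp only: sum_distrib_left mult.assoc)
    also have "\<dots> = 0" using row by (intro sum.neutral) auto
    finally show False using pos by simp
  qed
  then have "?M \<in> Units (ring_mat TYPE(real) (N + 1) ())"
    by (rule det_non_zero_imp_unit[OF M])
  then obtain X where "mat_inverse ?M = Some X"
    using mat_inverse(1)[OF M, of "()"] by (cases "mat_inverse ?M") auto
  then show ?thesis using mat_inverse(2)[OF M] that by blast
qed

section \<open>Operators on sequences of functions of the space variable\<close>

type_synonym field_seq = "nat \<Rightarrow> real \<Rightarrow> real"
type_synonym field_op = "field_seq \<Rightarrow> field_seq"

definition mapp :: "imat \<Rightarrow> field_op" where
  "mapp M w k x = (\<Sum>l. M k l * w l x)"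

definition dx :: field_op where
  "dx w k x = deriv (w k) x"

definition oblock :: "nat set \<Rightarrow> nat set \<Rightarrow> field_op \<Rightarrow> field_op" where
  "oblock I J T w k x =
     (if k \<in> I then T (\<lambda>l y. if l \<in> J then w l y else 0) k x else 0)"

section \<open>The moment system\<close>

definition Bmat :: imat where
  "Bmat k l =
     (if l = k + 1 then (real k + 1) / (2 * real k + 1)
      else if k = l + 1 then real k / (2 * real k + 1)
      else 0)"

definition Cmat :: "(nat \<Rightarrow> real) \<Rightarrow> imat" where
  "Cmat \<sigma> k l = (if k = l then \<sigma> k else 0)"

definition Rop :: "(nat \<Rightarrow> real) \<Rightarrow> field_op" where
  "Rop \<sigma> w k x = - mapp Bmat (dx w) k x - mapp (Cmat \<sigma>) w k x"

text \<open>In what follows \<open>u k x t\<close> is the value of the \<open>k\<close>-th moment at position \<open>x\<close> and time \<open>t\<close>.\<close>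

definition moment_equation ::
    "(nat \<Rightarrow> real) \<Rightarrow> (nat \<Rightarrow> real \<Rightarrow> real \<Rightarrow> real) \<Rightarrow> nat \<Rightarrow> real \<Rightarrow> real \<Rightarrow> bool" where
  "moment_equation \<sigma> u k x t \<longleftrightarrow>
     deriv (\<lambda>s. u k x s) t
     + (if k = 0 then 0 else Bmat k (k - 1) * deriv (\<lambda>y. u (k - 1) y t) x)
     + Bmat k (k + 1) * deriv (\<lambda>y. u (k + 1) y t) x
     = - \<sigma> k * u k x t"

lemma moment_equation_iff_Rop:
  "moment_equation \<sigma> u k x t \<longleftrightarrow>
     deriv (\<lambda>s. u k x s) t = Rop \<sigma> (\<lambda>l y. u l y t) k x"
proof -
  let ?w = "\<lambda>l y. u l y t"
  have B: "mapp Bmat (dx ?w) k x =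
      (if k = 0 then 0 else Bmat k (k - 1) * dx ?w (k - 1) x) + Bmat k (k + 1) * dx ?w (k + 1) x"
  proof (cases k)
    case 0
    have "mapp Bmat (dx ?w) k x = (\<Sum>l\<in>{1}. Bmat k l * dx ?w l x)"
      unfolding mapp_def by (rule suminf_finite) (auto simp: Bmat_def 0)
    then show ?thesis by (simp add: 0)
  next
    case (Suc m)
    have "mapp Bmat (dx ?w) k x = (\<Sum>l\<in>{m, m + 2}. Bmat k l * dx ?w l x)"
      unfolding mapp_def by (rule suminf_finite) (auto simp: Bmat_def Suc)
    then show ?thesis by (simp add: Suc)
  qed
  have C: "mapp (Cmat \<sigma>) ?w k x = \<sigma> k * u k x t"
  proof -
    have "mapp (Cmat \<sigma>) ?w k x = (\<Sum>l\<in>{k}. Cmat \<sigma> k l * ?w l x)"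
      unfolding mapp_def by (rule suminf_finite) (auto simp: Cmat_def)
    then show ?thesis by (simp add: Cmat_def)
  qed
  show ?thesis
    unfolding moment_equation_def Rop_def B C unfolding dx_def by linarith
qed

section \<open>First order optimal prediction and the P_N closure\<close>

definition Emat :: "nat \<Rightarrow> imat \<Rightarrow> imat" where
  "Emat N A i j =
     (if j \<in> idxC N then
        (if i \<in> idxC N then (if i = j then 1 else 0)
         else mmul (blkFC N A) (inv_CC N A) i j)
      else 0)"

definition op_RCC :: "(nat \<Rightarrow> real) \<Rightarrow> nat \<Rightarrow> imat \<Rightarrow> field_op" where
  "op_RCC \<sigma> N A = oblock (idxC N) (idxC N) (Rop \<sigma> \<circ> mapp (Emat N A))"

definition op_equation ::
    "(nat \<Rightarrow> real) \<Rightarrow> nat \<Rightarrow> imat \<Rightarrow> (nat \<Rightarrow> real \<Rightarrow> real \<Rightarrow> real) \<Rightarrow> nat \<Rightarrow> real \<Rightarrow> real \<Rightarrow> bool" where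
  "op_equation \<sigma> N A u k x t \<longleftrightarrow>
     deriv (\<lambda>s. u k x s) t = op_RCC \<sigma> N A (\<lambda>l y. u l y t) k x"

definition pn_equation ::
    "(nat \<Rightarrow> real) \<Rightarrow> nat \<Rightarrow> (nat \<Rightarrow> real \<Rightarrow> real \<Rightarrow> real) \<Rightarrow> nat \<Rightarrow> real \<Rightarrow> real \<Rightarrow> bool" where
  "pn_equation \<sigma> N u k x t \<longleftrightarrow>
     moment_equation \<sigma> (\<lambda>l y s. if l > N then 0 else u l y s) k x t"

text \<open>Only the components \<open>u 0, \<dots>, u N\<close> enter the two closed systems.\<close>

definition classical :: "nat \<Rightarrow> (nat \<Rightarrow> real \<Rightarrow> real \<Rightarrow> real) \<Rightarrow> bool" where
  "classical N u \<longleftrightarrow>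
     (\<forall>k\<in>idxC N. \<forall>x. \<forall>t>0.
        (\<lambda>y. u k y t) differentiable (at x) \<and> (\<lambda>s. u k x s) differentiable (at t))"

definition op_system ::
    "(nat \<Rightarrow> real) \<Rightarrow> nat \<Rightarrow> imat \<Rightarrow> (nat \<Rightarrow> real \<Rightarrow> real \<Rightarrow> real) \<Rightarrow> bool" where
  "op_system \<sigma> N A u \<longleftrightarrow>
     classical N u \<and> (\<forall>k\<in>idxC N. \<forall>x. \<forall>t>0. op_equation \<sigma> N A u k x t)"

definition pn_system ::
    "(nat \<Rightarrow> real) \<Rightarrow> nat \<Rightarrow> (nat \<Rightarrow> real \<Rightarrow> real \<Rightarrow> real) \<Rightarrow> bool" where
  "pn_system \<sigma> N u \<longleftrightarrow>
     classical N u \<and> (\<forall>k\<in>idxC N. \<forall>x. \<forall>t>0. pn_equation \<sigma> N u k x t)"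

end

theory Submission
  imports Defs
begin

text \<open>
  \<open>B\<close> is tridiagonal, so \<open>B\<^sub>C\<^sub>F\<close> has the single nonzero entry \<open>(N, N + 1)\<close>. Hence the rows
  \<open>k \<le> N\<close> of \<open>B E\<close> differ from \<open>B\<^sub>C\<^sub>C\<close> only by \<open>B\<^sub>C\<^sub>F A\<^sub>F\<^sub>C A\<^sub>C\<^sub>C\<^sup>-\<^sup>1\<close>, which touches row \<open>N\<close> alone
  and sees only row \<open>N + 1\<close> of \<open>A\<^sub>F\<^sub>C A\<^sub>C\<^sub>C\<^sup>-\<^sup>1\<close>. The operator \<open>\<partial>\<^sub>x\<close> commutes with \<open>E\<close> since every
  row of \<open>E\<close> has finite support. If \<open>A\<^sub>F\<^sub>C = 0\<close>, then \<open>E\<close> is the truncation to the indices \<open>\<le> N\<close>.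
\<close>

text \<open>Turns the series of \<open>mapp\<close> into finite sums, so that no summability has to
  be checked.\<close>

lemma mapp_finite_support:
  assumes "finite S" and "\<And>l. l \<notin> S \<Longrightarrow> M k l = 0"
  shows "mapp M w k x = (\<Sum>l\<in>S. M k l * w l x)"
  unfolding mapp_def using assms by (intro suminf_finite) auto

lemma mmul_finite_support:
  assumes "finite S" and "\<And>l. l \<notin> S \<Longrightarrow> M i l = 0"
  shows "mmul M P i j = (\<Sum>l\<in>S. M i l * P l j)"
  unfolding mmul_def using assms by (intro suminf_finite) auto

lemma mmul_inv_CC_eq_0: "j \<notin> idxC N \<Longrightarrow> mmul P (inv_CC N A) i j = 0"
  by (simp add: mmul_def inv_CC_def)

lemma Bmat_eq_0: "l > k + 1 \<Longrightarrow> Bmat k l = 0"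
  by (simp add: Bmat_def)

lemma mmul_blkCF_Bmat:
  "mmul (blkCF N Bmat) P i j = (if i = N then (real N + 1) / (2 * real N + 1) * P (N + 1) j else 0)"
proof -
  have "mmul (blkCF N Bmat) P i j = (\<Sum>l\<in>{N + 1}. blkCF N Bmat i l * P l j)"
    by (rule mmul_finite_support) (auto simp: mblock_def idxC_def idxF_def Bmat_def)
  then show ?thesis
    by (auto simp: mblock_def idxC_def idxF_def Bmat_def)
qed

lemma mapp_Emat:
  "mapp (Emat N A) w k x = (\<Sum>j\<in>idxC N. Emat N A k j * w j x)"
  by (rule mapp_finite_support) (auto simp: idxC_def Emat_def)

text \<open>The columns of \<open>Emat\<close> in F vanish, so \<open>Emat\<close> absorbs the inner
  truncation that \<open>oblock\<close> performs in \<open>op_RCC\<close>.\<close>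

lemma mapp_Emat_truncate:
  "mapp (Emat N A) (\<lambda>l y. if l \<in> idxC N then w l y else 0) = mapp (Emat N A) w"
  by (intro ext) (simp add: mapp_Emat)

lemma mapp_Emat_C:
  assumes "k \<in> idxC N"
  shows "mapp (Emat N A) w k x = w k x"
proof -
  have "mapp (Emat N A) w k x = (\<Sum>j\<in>idxC N. if k = j then w j x else 0)"
    unfolding mapp_Emat using assms by (intro sum.cong) (auto simp: Emat_def)
  then show ?thesis using assms by (simp add: idxC_def)
qed

lemma mapp_Emat_eq_truncate:
  assumes "blkFC N A = (\<lambda>i j. 0)"
  shows "mapp (Emat N A) w = (\<lambda>l y. if l \<in> idxC N then w l y else 0)"
proof (intro ext)
  fix k x
  show "mapp (Emat N A) w k x = (if k \<in> idxC N then w k x else 0)"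
  proof (cases "k \<in> idxC N")
    case True
    then show ?thesis by (simp add: mapp_Emat_C)
  next
    case False
    with assms show ?thesis by (simp add: mapp_Emat Emat_def mmul_def)
  qed
qed

text \<open>Termwise differentiation of a finite sum. \<open>deriv\<close> is total, and its
  additivity is guaranteed only for differentiable functions.\<close>

lemma dx_mapp_Emat:
  assumes "\<And>j. j \<in> idxC N \<Longrightarrow> w j differentiable (at x)"
  shows "dx (mapp (Emat N A) w) k x = mapp (Emat N A) (dx w) k x"
proof -
  have "((\<lambda>y. \<Sum>j\<in>idxC N. Emat N A k j * w j y) has_field_derivative
      (\<Sum>j\<in>idxC N. Emat N A k j * deriv (w j) x)) (at x)"
    using assms
    by (intro DERIV_sum DERIV_cmult)
      (simp add: DERIV_deriv_iff_real_differentiable)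
  then show ?thesis
    unfolding dx_def mapp_Emat[abs_def] by (rule DERIV_imp_deriv)
qed

lemma op_RCC_eq_Rop:
  "k \<in> idxC N \<Longrightarrow> op_RCC \<sigma> N A w k x = Rop \<sigma> (mapp (Emat N A) w) k x"
  by (simp add: op_RCC_def oblock_def mapp_Emat_truncate)

lemma mapp_Bmat_Emat:
  fixes A :: imat
  assumes k: "k \<in> idxC N"
  defines "K \<equiv> mmul (blkFC N A) (inv_CC N A)"
  shows "mapp Bmat (mapp (Emat N A) v) k x =
    mapp (\<lambda>i j. blkCC N Bmat i j + mmul (blkCF N Bmat) K i j) v k x"
proof -
  have split: "{..N + 1} = insert (N + 1) (idxC N)" by (auto simp: idxC_def)
  have fin: "finite (idxC N)" and notin: "N + 1 \<notin> idxC N" by (simp_all add: idxC_def)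
  have last: "mapp (Emat N A) v (N + 1) x = (\<Sum>j\<in>idxC N. K (N + 1) j * v j x)"
    unfolding mapp_Emat K_def using notin by (intro sum.cong) (auto simp: Emat_def)
  \<comment> \<open>For \<open>k < N\<close> both sides vanish, since \<open>Bmat k (N + 1)\<close>
    is nonzero only for \<open>k = N\<close>. This form avoids a case split on \<open>k\<close>
    below.\<close>
  have M: "mmul (blkCF N Bmat) K k j = Bmat k (N + 1) * K (N + 1) j" for j
    using k unfolding mmul_blkCF_Bmat by (auto simp: Bmat_def idxC_def)
  have "mapp Bmat (mapp (Emat N A) v) k x
      = (\<Sum>l\<in>{..N + 1}. Bmat k l * mapp (Emat N A) v l x)"
    using k by (intro mapp_finite_support) (auto simp: idxC_def intro: Bmat_eq_0)
  \<comment> \<open>On C the matrix \<open>Emat\<close> acts as the identity, so \<open>K\<close>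
    enters only through the term \<open>l = N + 1\<close>.\<close>
  also have "\<dots> = (\<Sum>l\<in>idxC N. Bmat k l * v l x)
      + Bmat k (N + 1) * (\<Sum>j\<in>idxC N. K (N + 1) j * v j x)"
    unfolding split sum.insert[OF fin notin] last by (simp add: mapp_Emat_C)
  also have "\<dots> = (\<Sum>j\<in>idxC N. (blkCC N Bmat k j + mmul (blkCF N Bmat) K k j) * v j x)"
    using k unfolding M by (simp add: mblock_def sum_distrib_left algebra_simps flip: sum.distrib)
  \<comment> \<open>Back to a series: \<open>blkCC\<close> and, because of \<open>inv_CC\<close>,
    also \<open>K\<close> have zero columns outside C.\<close>
  also have "\<dots> = mapp (\<lambda>i j. blkCC N Bmat i j + mmul (blkCF N Bmat) K i j) v k x"
    using fin by (intro mapp_finite_support[symmetric])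
      (simp_all add: mblock_def mmul_blkCF_Bmat K_def mmul_inv_CC_eq_0)
  finally show ?thesis .
qed

text \<open>\<open>Cmat\<close> is diagonal and does not couple C to F, so the rows of
  \<open>Emat\<close> in F never enter.\<close>

lemma mapp_Cmat_Emat:
  assumes "k \<in> idxC N"
  shows "mapp (Cmat \<sigma>) (mapp (Emat N A) w) k x = mapp (blkCC N (Cmat \<sigma>)) w k x"
proof -
  have "mapp (Cmat \<sigma>) (mapp (Emat N A) w) k x
      = (\<Sum>l\<in>{k}. Cmat \<sigma> k l * mapp (Emat N A) w l x)"
    by (rule mapp_finite_support) (auto simp: Cmat_def)
  moreover have "mapp (blkCC N (Cmat \<sigma>)) w k x = (\<Sum>l\<in>{k}. blkCC N (Cmat \<sigma>) k l * w l x)"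
    by (rule mapp_finite_support) (auto simp: Cmat_def mblock_def)
  ultimately show ?thesis
    using assms by (simp add: mapp_Emat_C mblock_def)
qed

lemma op_RCC_eq:
  fixes A :: imat
  assumes w: "\<And>j y. j \<in> idxC N \<Longrightarrow> w j differentiable (at y)" and k: "k \<in> idxC N"
  defines "K \<equiv> mmul (blkFC N A) (inv_CC N A)"
  shows "op_RCC \<sigma> N A w k x =
    - mapp (\<lambda>i j. blkCC N Bmat i j + mmul (blkCF N Bmat) K i j) (dx w) k x
    - mapp (blkCC N (Cmat \<sigma>)) w k x"
proof -
  \<comment> \<open>All components are needed, not only those in C: row \<open>N\<close> of
    \<open>Bmat\<close> reads the derivative of component \<open>N + 1\<close>.\<close>
  have "dx (mapp (Emat N A) w) = mapp (Emat N A) (dx w)"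
    using w by (intro ext dx_mapp_Emat)
  with k show ?thesis
    by (simp add: op_RCC_eq_Rop Rop_def mapp_Bmat_Emat mapp_Cmat_Emat K_def)
qed

text \<open>Both right-hand sides are \<open>Rop\<close> applied to the same truncated
  field.\<close>

lemma op_equation_iff_pn_equation:
  assumes "blkFC N A = (\<lambda>i j. 0)" and "k \<in> idxC N"
  shows "op_equation \<sigma> N A u k x t \<longleftrightarrow> pn_equation \<sigma> N u k x t"
proof -
  have "(\<lambda>l y. if l > N then 0 else u l y t) = (\<lambda>l y. if l \<in> idxC N then u l y t else 0)"
    by (intro ext) (auto simp: idxC_def)
  \<comment> \<open>Hence truncation leaves the time derivative of component \<open>k\<close>
    unchanged.\<close>
  moreover have "\<not> k > N" using assms(2) by (simp add: idxC_def)
  ultimately show ?thesis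
    using assms
    by (simp add: op_equation_def pn_equation_def moment_equation_iff_Rop op_RCC_eq_Rop
        mapp_Emat_eq_truncate)
qed

theorem mainTheorem2:
  fixes N :: nat and \<sigma> :: "nat \<Rightarrow> real" and A :: "nat \<Rightarrow> nat \<Rightarrow> real"
  assumes "symmetric_imat A" and "pos_def_imat A"
  defines "K \<equiv> mmul (blkFC N A) (inv_CC N A)"
  defines "M \<equiv> mmul (blkCF N Bmat) K"
  shows
    "(\<forall>w. (\<forall>k\<in>idxC N. \<forall>x. w k differentiable (at x)) \<longrightarrow>
        (\<forall>k\<in>idxC N. \<forall>x.
           op_RCC \<sigma> N A w k x =
             - mapp (\<lambda>i j. blkCC N Bmat i j + M i j) (dx w) k x
             - mapp (blkCC N (Cmat \<sigma>)) w k x))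
     \<and> (\<forall>i\<in>idxC N. \<forall>j\<in>idxC N. M i j \<noteq> 0 \<longrightarrow> i = N)
     \<and> (\<forall>j\<in>idxC N. M N j = (real N + 1) / (2 * real N + 1) * K (N + 1) j)
     \<and> (blkFC N A = (\<lambda>i j. 0) \<longrightarrow>
          (\<forall>u. op_system \<sigma> N A u \<longleftrightarrow> pn_system \<sigma> N u) \<and>
          (\<forall>u. classical N u \<longrightarrow>
             (\<forall>k\<in>idxC N. \<forall>x. \<forall>t>0. op_equation \<sigma> N A u k x t \<longleftrightarrow> pn_equation \<sigma> N u k x t)))"
proof (intro conjI allI ballI impI)
  fix w :: field_seq and k x
  assume "\<forall>k\<in>idxC N. \<forall>x. w k differentiable (at x)" and "k \<in> idxC N"
  then show "op_RCC \<sigma> N A w k x =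
      - mapp (\<lambda>i j. blkCC N Bmat i j + M i j) (dx w) k x - mapp (blkCC N (Cmat \<sigma>)) w k x"
    unfolding M_def K_def by (intro op_RCC_eq) auto
next
  fix i j
  assume "M i j \<noteq> 0"
  then show "i = N" by (simp add: M_def mmul_blkCF_Bmat split: if_splits)
next
  fix j
  show "M N j = (real N + 1) / (2 * real N + 1) * K (N + 1) j"
    by (simp add: M_def mmul_blkCF_Bmat)
next
  fix u
  assume "blkFC N A = (\<lambda>i j. 0)"
  \<comment> \<open>The two systems share the conjunct \<open>classical N u\<close>, so equivalence
    of the single equations suffices.\<close>
  then show "op_system \<sigma> N A u \<longleftrightarrow> pn_system \<sigma> N u"
    by (simp add: op_system_def pn_system_def op_equation_iff_pn_equation)
next
  fix u k x and t :: real
  assume "blkFC N A = (\<lambda>i j. 0)" and "k \<in> idxC N"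
  then show "op_equation \<sigma> N A u k x t \<longleftrightarrow> pn_equation \<sigma> N u k x t"
    by (rule op_equation_iff_pn_equation)
qed

end
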